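(* Let $(Y,\|\cdot\|)$ be a normed space and $K\subset Y$ a closed, convex and pointed cone. Let $\Psi\in\Omega_{QD}$. Then $\Psi$ is $K$-monotone and $$-K=\{y\in Y:\Psi(y)\le 0\}.$$ If $\operatorname{int}(K)\neq\emptyset$, then $\Psi$ is strictly $K$-monotone and $$-\operatorname{int}(K)=\{y\in Y:\Psi(y)<0\}.$$
   Context: Spaces are real; $Y^*$ is the topological dual. A cone is a set $C$ with $tx\in C$ for all $x\in C$, $t\ge 0$. $K^*=\{y^*\in Y^*:\langle y^*,y\rangle\ge 0\ \forall y\in K\}$; $\operatorname{int}$ of a subset of $Y^*$ is the norm interior. $\Psi$ is $K$-monotone if $z-y\in K\Rightarrow\Psi(y)\le\Psi(z)$, and strictly $K$-monotone if $z-y\in\operatorname{int}(K)\Rightarrow\Psi(y)<\Psi(z)$. For $A\subseteq Y^*$, $\sigma_A(y):=\sup_{y^*\in A}\langle y^*,y\rangle$, and for $y\in Y$ the $y$-face of $A$ is $A^y:=\{y^*\in A:\langle y^*,y\rangle=\sigma_A(y)\}$. For $A,B\subseteq Y^*$: $A\preceq_l^{K^*}B$ iff $B\subseteq A+K^*$; $A\preceq_u^{K^*}B$ iff $A\subseteq B-K^*$; $A\preceq_s^{K^*}B$ iff both hold. For $y\in Y$, $P(y):=\{y^*\in Y^*:\langle y^*,y\rangle\ge 0\}$. For nonempty convex $w^*$-compact $G,H\subseteq Y^*$, the pair $[G,H]$ is a scalarization pair, written $[G,H]\in\mathbb{S}(K)$, if (i) $H^y\preceq_s^{K^*}G^y$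 for every $y\in Y$; (ii) $H\cap G=\emptyset$; (iii) $H\subseteq\bigcap_{y\notin -K}\left(G-\operatorname{int}(P(y))\right)$. $\Omega_{QD}:=\{\Psi:Y\to\mathbb{R}\ :\ \exists\,[G,H]\in\mathbb{S}(K)\text{ with }\Psi=\sigma_G-\sigma_H\}$. *)

theory Defs
  imports "HOL-Analysis.Analysis"
begin

text \<open>The topological dual of a real normed space \<open>'a\<close> is the type \<open>'a \<Rightarrow>\<^sub>L real\<close>. Its weak-star
  topology is the topology of pointwise convergence, i.e. the library's strong operator topology
  for the scalar codomain \<open>real\<close>; \<open>interior\<close> on this type refers to the operator norm.\<close>

abbreviation weak_star_topology :: "('a::real_normed_vector \<Rightarrow>\<^sub>L real) topology" where
  "weak_star_topology \<equiv> strong_operator_topology"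

definition pointed :: "'a::real_vector set \<Rightarrow> bool" where
  "pointed K \<longleftrightarrow> K \<inter> uminus ` K = {0}"

definition dual_cone :: "'a::real_normed_vector set \<Rightarrow> ('a \<Rightarrow>\<^sub>L real) set" where
  "dual_cone K = {f. \<forall>y\<in>K. 0 \<le> blinfun_apply f y}"

definition K_monotone :: "'a::real_normed_vector set \<Rightarrow> ('a \<Rightarrow> real) \<Rightarrow> bool" where
  "K_monotone K \<Psi> \<longleftrightarrow> (\<forall>y z. z - y \<in> K \<longrightarrow> \<Psi> y \<le> \<Psi> z)"

definition strictly_K_monotone :: "'a::real_normed_vector set \<Rightarrow> ('a \<Rightarrow> real) \<Rightarrow> bool" where
  "strictly_K_monotone K \<Psi> \<longleftrightarrow> (\<forall>y z. z - y \<in> interior K \<longrightarrow> \<Psi> y < \<Psi> z)"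

text \<open>The supremum is taken in \<open>real\<close>, so \<open>support_fun A\<close> is meaningful only if \<open>A\<close> is nonempty
  and pointwise bounded above. Below it is applied only to nonempty weak-star compact sets,
  where this is the case (the supremum is even attained).\<close>

definition support_fun :: "('a::real_normed_vector \<Rightarrow>\<^sub>L real) set \<Rightarrow> 'a \<Rightarrow> real" where
  "support_fun A y = (SUP f\<in>A. blinfun_apply f y)"

definition face :: "('a::real_normed_vector \<Rightarrow>\<^sub>L real) set \<Rightarrow> 'a \<Rightarrow> ('a \<Rightarrow>\<^sub>L real) set" where
  "face A y = {f \<in> A. blinfun_apply f y = support_fun A y}"

definition minkowski_sum :: "'b::ab_group_add set \<Rightarrow> 'b set \<Rightarrow> 'b set" where
  "minkowski_sum A B = {a + b | a b. a \<in> A \<and> b \<in> B}"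

definition minkowski_diff :: "'b::ab_group_add set \<Rightarrow> 'b set \<Rightarrow> 'b set" where
  "minkowski_diff A B = {a - b | a b. a \<in> A \<and> b \<in> B}"

text \<open>The lower, upper and set less relations with respect to an ordering cone \<open>C\<close>, which will
  be the dual cone of \<open>K\<close>.\<close>

definition lower_less :: "'b::ab_group_add set \<Rightarrow> 'b set \<Rightarrow> 'b set \<Rightarrow> bool" where
  "lower_less C A B \<longleftrightarrow> B \<subseteq> minkowski_sum A C"

definition upper_less :: "'b::ab_group_add set \<Rightarrow> 'b set \<Rightarrow> 'b set \<Rightarrow> bool" where
  "upper_less C A B \<longleftrightarrow> A \<subseteq> minkowski_diff B C"

definition set_less :: "'b::ab_group_add set \<Rightarrow> 'b set \<Rightarrow> 'b set \<Rightarrow> bool" where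
  "set_less C A B \<longleftrightarrow> lower_less C A B \<and> upper_less C A B"

definition nonneg_functionals :: "'a::real_normed_vector \<Rightarrow> ('a \<Rightarrow>\<^sub>L real) set" where
  "nonneg_functionals y = {f. 0 \<le> blinfun_apply f y}"

definition scalarization_pairs ::
  "'a::real_normed_vector set \<Rightarrow> (('a \<Rightarrow>\<^sub>L real) set \<times> ('a \<Rightarrow>\<^sub>L real) set) set" where
  "scalarization_pairs K = {(G, H).
     G \<noteq> {} \<and> convex G \<and> compactin weak_star_topology G \<and>
     H \<noteq> {} \<and> convex H \<and> compactin weak_star_topology H \<and>
     (\<forall>y. set_less (dual_cone K) (face H y) (face G y)) \<and>
     H \<inter> G = {} \<and>
     H \<subseteq> (\<Inter>y\<in>- (uminus ` K). minkowski_diff G (interior (nonneg_functionals y)))}"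

definition Omega_QD :: "'a::real_normed_vector set \<Rightarrow> ('a \<Rightarrow> real) set" where
  "Omega_QD K =
     {\<Psi>. \<exists>G H. (G, H) \<in> scalarization_pairs K \<and> \<Psi> = (\<lambda>y. support_fun G y - support_fun H y)}"

end

(* Members of the faces of G and H at u are subgradients of the two support functions, and (i)
   supplies at each u a pair g_u, h_u with h_u(k) <= g_u(k) for all k in K. Summing the subgradient
   inequalities over a partition of the segment from y to y + k into n equal parts, the h-terms
   telescope to something of order 1/n, so Psi(y) <= Psi(y + k). If equality holds with k in the
   interior of K, then Psi is constant on the segment, and at a continuity point of the monotone
   function u |-> h_u(k) one gets g_u(k) = h_u(k); a functional in the dual cone that vanishes at an
   interior point is zero, so g_u = h_u, contradicting (ii). Positivity of Psi off -K is (iii)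
   together with the Hahn-Banach fact that every nonzero vector is positive under some functional.
   The strict sublevel set is found by moving from y a little along an interior direction e:
   Psi(y + t e) is still negative, so y lies in -K - t e. *)
theory Submission
  imports Defs
begin

section \<open>Sublinear functionals and the existence of a positive continuous functional\<close>

definition sublinear :: "('a::real_vector \<Rightarrow> real) \<Rightarrow> bool" where
  "sublinear p \<longleftrightarrow> (\<forall>x y. p (x + y) \<le> p x + p y) \<and> (\<forall>c>0. \<forall>x. p (c *\<^sub>R x) \<le> c * p x)"

lemma sublinear_add: "sublinear p \<Longrightarrow> p (x + y) \<le> p x + p y"
  by (simp add: sublinear_def)

lemma sublinear_zero:
  assumes "sublinear p"
  shows "p 0 = 0"
proof -
  have "p (2 *\<^sub>R 0) \<le> 2 * p 0" "p ((1/2) *\<^sub>R 0) \<le> (1/2) * p 0"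
    using assms unfolding sublinear_def by (meson zero_less_numeral half_gt_zero_iff zero_less_one)+
  then show ?thesis by simp
qed

text \<open>Applying the defining inequality with factor \<open>inverse c\<close> to
  \<open>c *\<^sub>R x\<close> gives the reverse one, so the definition can ask for
  \<open>\<le>\<close> and positive \<open>c\<close>.\<close>

lemma sublinear_scaleR:
  assumes "sublinear p" "0 \<le> c"
  shows "p (c *\<^sub>R x) = c * p x"
proof (cases "c = 0")
  case True
  then show ?thesis using sublinear_zero[OF assms(1)] by simp
next
  case False
  then have c: "c > 0" using assms by simp
  have "p (inverse c *\<^sub>R (c *\<^sub>R x)) \<le> inverse c * p (c *\<^sub>R x)"
    using assms c unfolding sublinear_def by (meson positive_imp_inverse_positive)
  then have "c * p x \<le> p (c *\<^sub>R x)"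
    using c by (simp add: field_simps)
  moreover have "p (c *\<^sub>R x) \<le> c * p x"
    using assms c by (simp add: sublinear_def)
  ultimately show ?thesis by simp
qed

lemma sublinear_minus: "sublinear p \<Longrightarrow> - p (- x) \<le> p x"
  using sublinear_add[of p x "- x"] sublinear_zero[of p] by simp

lemma sublinear_norm: "sublinear norm"
  by (auto simp: sublinear_def norm_triangle_ineq)

text \<open>Below a minimal sublinear functional \<open>p\<close> there is no smaller shift, which forces
  \<open>p (- y) \<le> - p y\<close> for all \<open>y\<close>, hence linearity.\<close>

definition sublinear_shift :: "('a::real_vector \<Rightarrow> real) \<Rightarrow> 'a \<Rightarrow> 'a \<Rightarrow> real" where
  "sublinear_shift p y x = (INF t\<in>{0..}. p (x + t *\<^sub>R y) - t * p y)"

lemma sublinear_shift_le: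
  assumes "sublinear p" "0 \<le> t"
  shows "sublinear_shift p y x \<le> p (x + t *\<^sub>R y) - t * p y"
proof -
  \<comment> \<open>Subadditivity at \<open>t *\<^sub>R y = (x + t *\<^sub>R y) + (- x)\<close>
    bounds the family below by a constant free of \<open>t\<close>; otherwise the real
    \<open>INF\<close> would carry no information.\<close>
  have "- p (- x) \<le> p (x + t *\<^sub>R y) - t * p y" if "0 \<le> t" for t
    using sublinear_add[OF assms(1), of "x + t *\<^sub>R y" "- x"] sublinear_scaleR[OF assms(1) that, of y]
    by simp
  then have "bdd_below ((\<lambda>t. p (x + t *\<^sub>R y) - t * p y) ` {0..})"
    by (intro bdd_belowI2[where m = "- p (- x)"]) auto
  then show ?thesis
    unfolding sublinear_shift_def using assms(2) by (intro cINF_lower) auto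
qed

lemma sublinear_shift_greatest:
  assumes "\<And>t. 0 \<le> t \<Longrightarrow> c \<le> p (x + t *\<^sub>R y) - t * p y"
  shows "c \<le> sublinear_shift p y x"
  unfolding sublinear_shift_def using assms by (intro cINF_greatest) auto

lemma sublinear_shift_le_self: "sublinear p \<Longrightarrow> sublinear_shift p y x \<le> p x"
  using sublinear_shift_le[of p 0 y x] by simp

lemma sublinear_shift_minus: "sublinear p \<Longrightarrow> sublinear_shift p y (- y) \<le> - p y"
  using sublinear_shift_le[of p 1 y "- y"] sublinear_zero[of p] by simp

text \<open>Parameters \<open>s\<close> for \<open>x\<close> and \<open>t\<close> for
  \<open>z\<close> combine to \<open>s + t\<close> for \<open>x + z\<close>, and \<open>t\<close>
  for \<open>x\<close> becomes \<open>c * t\<close> for \<open>c *\<^sub>R x\<close>.\<close>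

lemma sublinear_sublinear_shift:
  assumes p: "sublinear p"
  shows "sublinear (sublinear_shift p y)"
  unfolding sublinear_def
proof (intro conjI allI impI)
  fix x z
  let ?q = "sublinear_shift p y"
  have *: "?q (x + z) \<le> (p (x + s *\<^sub>R y) - s * p y) + (p (z + t *\<^sub>R y) - t * p y)"
    if "0 \<le> s" "0 \<le> t" for s t
  proof -
    have "?q (x + z) \<le> p ((x + z) + (s + t) *\<^sub>R y) - (s + t) * p y"
      using that by (intro sublinear_shift_le p) auto
    also have "(x + z) + (s + t) *\<^sub>R y = (x + s *\<^sub>R y) + (z + t *\<^sub>R y)"
      by (simp add: algebra_simps)
    finally show ?thesis
      using sublinear_add[OF p, of "x + s *\<^sub>R y" "z + t *\<^sub>R y"] by (simp add: algebra_simps)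
  qed
  have "?q (x + z) - (p (z + t *\<^sub>R y) - t * p y) \<le> ?q x" if "0 \<le> t" for t
    by (rule sublinear_shift_greatest) (use *[OF _ that] in \<open>simp add: algebra_simps\<close>)
  then have "?q (x + z) - ?q x \<le> ?q z"
    by (intro sublinear_shift_greatest) (simp add: algebra_simps)
  then show "?q (x + z) \<le> ?q x + ?q z" by simp
next
  fix c :: real and x
  assume c: "0 < c"
  let ?q = "sublinear_shift p y"
  have "?q (c *\<^sub>R x) / c \<le> ?q x"
  proof (rule sublinear_shift_greatest)
    fix t :: real assume t: "0 \<le> t"
    have "?q (c *\<^sub>R x) \<le> p (c *\<^sub>R x + (c * t) *\<^sub>R y) - (c * t) * p y"
      using t c by (intro sublinear_shift_le p) auto
    also have "c *\<^sub>R x + (c * t) *\<^sub>R y = c *\<^sub>R (x + t *\<^sub>R y)"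
      by (simp add: scaleR_right_distrib)
    also have "p (c *\<^sub>R (x + t *\<^sub>R y)) = c * p (x + t *\<^sub>R y)"
      using c by (intro sublinear_scaleR p) auto
    finally show "?q (c *\<^sub>R x) / c \<le> p (x + t *\<^sub>R y) - t * p y"
      using c by (simp add: field_simps)
  qed
  then show "?q (c *\<^sub>R x) \<le> c * ?q x"
    using c by (simp add: field_simps)
qed

text \<open>An infimum of sublinear functionals need not be subadditive; in a chain, the smaller of
  \<open>p\<close> and \<open>q\<close> can serve both summands.\<close>

lemma sublinear_Inf_chain:
  fixes C :: "('a::real_vector \<Rightarrow> real) set"
  assumes "C \<noteq> {}" and sub: "\<And>p. p \<in> C \<Longrightarrow> sublinear p"
    and chain: "\<And>p q. p \<in> C \<Longrightarrow> q \<in> C \<Longrightarrow> p \<le> q \<or> q \<le> p"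
    and bdd: "\<And>x. bdd_below ((\<lambda>p. p x) ` C)"
  shows "sublinear (\<lambda>x. INF p\<in>C. p x)"
  unfolding sublinear_def
proof (intro conjI allI impI)
  let ?m = "\<lambda>x. INF p\<in>C. p x"
  have lower: "?m x \<le> p x" if "p \<in> C" for p x
    using that bdd by (intro cINF_lower) auto
  have greatest: "c \<le> ?m x" if "\<And>p. p \<in> C \<Longrightarrow> c \<le> p x" for c x
    using that assms(1) by (intro cINF_greatest) auto
  {
    fix x z
    have *: "?m (x + z) \<le> p x + q z" if "p \<in> C" "q \<in> C" for p q
    proof -
      have "\<exists>r\<in>C. r \<le> p \<and> r \<le> q" using chain[OF that] that by auto
      then obtain r where r: "r \<in> C" "r \<le> p" "r \<le> q" by blast
      have "?m (x + z) \<le> r (x + z)" using r lower by blast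
      also have "\<dots> \<le> r x + r z" using sub r sublinear_add by blast
      also have "\<dots> \<le> p x + q z" using r by (intro add_mono) (auto simp: le_fun_def)
      finally show ?thesis .
    qed
    have "?m (x + z) - q z \<le> ?m x" if "q \<in> C" for q
      by (rule greatest) (use *[OF _ that] in \<open>simp add: algebra_simps\<close>)
    then have "?m (x + z) - ?m x \<le> ?m z"
      by (intro greatest) (simp add: algebra_simps)
    then show "?m (x + z) \<le> ?m x + ?m z" by simp
  }
  fix c :: real and x
  assume c: "0 < c"
  have "?m (c *\<^sub>R x) / c \<le> ?m x"
  proof (rule greatest)
    fix p assume "p \<in> C"
    then show "?m (c *\<^sub>R x) / c \<le> p x"
      using lower[of p "c *\<^sub>R x"] sublinear_scaleR[OF sub, of p c x] c by (simp add: field_simps)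
  qed
  then show "?m (c *\<^sub>R x) \<le> c * ?m x"
    using c by (simp add: field_simps)
qed

lemma exists_minimal_sublinear:
  fixes p :: "'a::real_vector \<Rightarrow> real"
  assumes p: "sublinear p"
  obtains f where "sublinear f" "f \<le> p" "\<And>q. sublinear q \<Longrightarrow> q \<le> f \<Longrightarrow> q = f"
proof -
  define A where "A = {q. sublinear q \<and> q \<le> p}"
  have "\<exists>m\<in>A. \<forall>a\<in>A. a \<le> m \<longrightarrow> a = m"
  \<comment> \<open>The order is reversed, so Zorn's lemma yields a minimal functional and chains
    need lower bounds.\<close>
  proof (rule predicate_Zorn)
    show "partial_order_on A (relation_of (\<lambda>q r. r \<le> q) A)"
      by (auto simp: partial_order_on_def preorder_on_def refl_on_def relation_of_def
          intro!: transI antisymI)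
  next
    fix C assume "C \<in> Chains (relation_of (\<lambda>q r. r \<le> q) A)"
    then have C: "C \<subseteq> A" "\<And>q r. q \<in> C \<Longrightarrow> r \<in> C \<Longrightarrow> q \<le> r \<or> r \<le> q"
      by (auto simp: Chains_def relation_of_def)
    show "\<exists>u\<in>A. \<forall>a\<in>C. u \<le> a"
    proof (cases "C = {}")
      case True
      then show ?thesis using p by (auto simp: A_def)
    next
      case False
      \<comment> \<open>This bound does not depend on \<open>q\<close>, so the pointwise infimum
        over the chain is finite.\<close>
      have "- p (- x) \<le> q x" if "q \<in> C" for q x
      proof -
        have "sublinear q" "q (- x) \<le> p (- x)" using that C(1) by (auto simp: A_def le_fun_def)
        then show ?thesis using sublinear_minus[of q x] by simp
      qed
      then have bdd: "bdd_below ((\<lambda>q. q x) ` C)" for x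
        by (intro bdd_belowI2[where m = "- p (- x)"]) auto
      have sub: "sublinear (\<lambda>x. INF q\<in>C. q x)"
        using False C bdd by (intro sublinear_Inf_chain) (auto simp: A_def)
      have le: "(\<lambda>x. INF q\<in>C. q x) \<le> q" if "q \<in> C" for q
        using that bdd by (auto simp: le_fun_def intro!: cINF_lower)
      obtain q where "q \<in> C" using False by blast
      then have "(\<lambda>x. INF q\<in>C. q x) \<in> A"
        using sub le[of q] C(1) by (auto simp: A_def)
      then show ?thesis using le by blast
    qed
  qed
  then obtain m where m: "m \<in> A" "\<And>a. a \<in> A \<Longrightarrow> a \<le> m \<Longrightarrow> a = m" by blast
  show thesis
  proof (rule that[of m])
    show "sublinear m" "m \<le> p" using m(1) by (auto simp: A_def)
    show "q = m" if "sublinear q" "q \<le> m" for q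
      using that m(1) by (intro m(2)) (auto simp: A_def)
  qed
qed

lemma minimal_sublinear_imp_linear:
  assumes f: "sublinear f" and min: "\<And>q. sublinear q \<Longrightarrow> q \<le> f \<Longrightarrow> q = f"
  shows "linear f"
proof -
  have "f (- y) \<le> - f y" for y
  proof -
    have "sublinear_shift f y = f"
      using f by (intro min sublinear_sublinear_shift) (auto simp: le_fun_def sublinear_shift_le_self)
    then show ?thesis using sublinear_shift_minus[OF f, of y] by simp
  qed
  then have odd: "f (- y) = - f y" for y
    using sublinear_minus[OF f, of "- y"] by (metis add.inverse_inverse eq_iff neg_le_iff_le)
  show ?thesis
  proof (rule linearI)
    fix x y
    \<comment> \<open>For odd \<open>f\<close>, subadditivity at \<open>- x\<close> and
      \<open>- y\<close> is superadditivity at \<open>x\<close> and \<open>y\<close>.\<close>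
    have "f (- x + - y) \<le> f (- x) + f (- y)" using f sublinear_add by blast
    moreover have "f (- x + - y) = - f (x + y)" using odd[of "x + y"] by simp
    ultimately show "f (x + y) = f x + f y"
      using sublinear_add[OF f, of x y] odd by (simp add: eq_iff)
  next
    fix c :: real and x
    show "f (c *\<^sub>R x) = c *\<^sub>R f x"
    proof (cases "0 \<le> c")
      case True
      then show ?thesis using sublinear_scaleR[OF f] by simp
    next
      case False
      then show ?thesis
        using sublinear_scaleR[OF f, of "- c" x] odd[of "c *\<^sub>R x"] by simp
    qed
  qed
qed

text \<open>A minimal functional below the norm itself could vanish at \<open>y\<close>. Starting
  from the shift of the norm along \<open>y\<close> forces \<open>f (- y) \<le> - norm y\<close>,
  while domination by the norm still makes \<open>f\<close> continuous.\<close>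

lemma exists_blinfun_pos:
  fixes y :: "'a::real_normed_vector"
  assumes "y \<noteq> 0"
  obtains f :: "'a \<Rightarrow>\<^sub>L real" where "0 < blinfun_apply f y"
proof -
  let ?p = "sublinear_shift norm y"
  obtain f where f: "sublinear f" "f \<le> ?p" and min: "\<And>q. sublinear q \<Longrightarrow> q \<le> f \<Longrightarrow> q = f"
    using exists_minimal_sublinear[OF sublinear_sublinear_shift[OF sublinear_norm]] by metis
  have lin: "linear f" using minimal_sublinear_imp_linear[OF f(1) min] by blast
  have le: "f x \<le> norm x" for x
    using le_funD[OF f(2), of x] sublinear_shift_le_self[OF sublinear_norm, of y x] by linarith
  have "\<bar>f x\<bar> \<le> norm x" for x
    using le[of x] le[of "- x"] linear_neg[OF lin, of x] by simp
  then have "bounded_linear f"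
    using lin by (intro bounded_linear_intro[where K = 1]) (auto simp: linear_add linear_scale)
  moreover have "f (- y) \<le> - norm y"
    using le_funD[OF f(2), of "- y"] sublinear_shift_minus[OF sublinear_norm, of y] by linarith
  then have "0 < f y" using assms linear_neg[OF lin, of y]
    by (smt (verit) zero_less_norm_iff)
  ultimately show thesis
    using that[of "Blinfun f"] by (simp add: bounded_linear_Blinfun_apply)
qed

section \<open>Interior points of half-spaces of functionals and of the ordering cone\<close>

lemma blinfun_pos_of_interior_nonneg_functionals:
  assumes "p \<in> interior (nonneg_functionals y)" "y \<noteq> 0"
  shows "0 < blinfun_apply p y"
proof -
  obtain e where e: "e > 0" "cball p e \<subseteq> nonneg_functionals y"
    using assms(1) mem_interior_cball by blast
  obtain f :: "'a \<Rightarrow>\<^sub>L real" where f: "0 < blinfun_apply f y"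
    using exists_blinfun_pos[OF assms(2)] .
  then have nz: "norm f > 0" by (auto simp: blinfun.zero_left)
  \<comment> \<open>The displacement has norm exactly \<open>e\<close> and strictly lowers the value
    at \<open>y\<close>, yet that value stays nonnegative.\<close>
  let ?g = "p - (e / norm f) *\<^sub>R f"
  have "?g \<in> cball p e" using nz e by (simp add: dist_norm)
  then have "?g \<in> nonneg_functionals y" using e(2) by blast
  then have "0 \<le> blinfun_apply ?g y" by (simp add: nonneg_functionals_def)
  then have "(e / norm f) * blinfun_apply f y \<le> blinfun_apply p y"
    by (simp add: blinfun.diff_left blinfun.scaleR_left)
  moreover have "0 < (e / norm f) * blinfun_apply f y" using e nz f by simp
  ultimately show ?thesis by linarith
qed

text \<open>From \<open>e\<close> a small step in any direction \<open>x\<close> stays in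
  \<open>K\<close>, so \<open>f\<close> is nonnegative at both \<open>x\<close> and
  \<open>- x\<close>.\<close>

lemma dual_cone_eq_zero_of_interior:
  assumes "f \<in> dual_cone K" "e \<in> interior K" "blinfun_apply f e = 0"
  shows "f = 0"
proof (rule blinfun_eqI)
  have *: "0 \<le> blinfun_apply f x" for x
  proof (cases "x = 0")
    case False
    obtain d where d: "d > 0" "cball e d \<subseteq> K"
      using assms(2) mem_interior_cball by blast
    have "e + (d / norm x) *\<^sub>R x \<in> K" using d False by (auto simp: dist_norm subset_iff)
    then have "0 \<le> blinfun_apply f (e + (d / norm x) *\<^sub>R x)"
      using assms(1) by (auto simp: dual_cone_def)
    then show ?thesis using assms(3) d False
      by (simp add: blinfun.add_right blinfun.scaleR_right zero_le_mult_iff zero_le_divide_iff)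
  qed (simp add: blinfun.zero_right)
  show "blinfun_apply f x = blinfun_apply 0 x" for x
    using *[of x] *[of "- x"] by (simp add: blinfun.minus_right blinfun.zero_left)
qed

section \<open>Support functions and faces of weak-star compact sets\<close>

lemma compact_evaluation_image:
  assumes "compactin weak_star_topology A"
  shows "compact ((\<lambda>f. blinfun_apply f y) ` A)"
  using image_compactin[OF assms strong_operator_topology_continuous_evaluation]
  by (simp add: compactin_euclidean_iff)

lemma blinfun_le_support_fun:
  assumes "compactin weak_star_topology A" "f \<in> A"
  shows "blinfun_apply f y \<le> support_fun A y"
  unfolding support_fun_def
  using compact_evaluation_image[OF assms(1), of y] assms(2)
  by (intro cSUP_upper compact_imp_bounded bounded_imp_bdd_above)

lemma face_nonempty:
  assumes "compactin weak_star_topology A" "A \<noteq> {}"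
  shows "face A y \<noteq> {}"
proof -
  have "compact ((\<lambda>f. blinfun_apply f y) ` A)" "(\<lambda>f. blinfun_apply f y) ` A \<noteq> {}"
    using compact_evaluation_image assms by auto
  from compact_attains_sup[OF this] obtain f
    where f: "f \<in> A" "\<And>g. g \<in> A \<Longrightarrow> blinfun_apply g y \<le> blinfun_apply f y"
    by auto
  then have "support_fun A y = blinfun_apply f y"
    unfolding support_fun_def by (intro cSup_eq_maximum) auto
  then show ?thesis using f(1) by (auto simp: face_def)
qed

text \<open>At \<open>y\<close> the functional attains the support function, and at \<open>z\<close>
  it is bounded by it.\<close>

lemma face_subgradient:
  assumes "compactin weak_star_topology A" "f \<in> face A y"
  shows "blinfun_apply f (z - y) \<le> support_fun A z - support_fun A y"
  using blinfun_le_support_fun[OF assms(1), of f z] assms(2)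
  by (simp add: face_def blinfun.diff_right)

lemma support_fun_zero: "A \<noteq> {} \<Longrightarrow> support_fun A 0 = 0"
  by (simp add: support_fun_def blinfun.zero_right)

section \<open>Monotonicity, continuity and sign of the difference of support functions\<close>

locale support_pair =
  fixes K :: "'a::real_normed_vector set" and G H :: "('a \<Rightarrow>\<^sub>L real) set"
  assumes G: "compactin weak_star_topology G" "G \<noteq> {}"
    and H: "compactin weak_star_topology H" "H \<noteq> {}"
    and faces: "set_less (dual_cone K) (face H y) (face G y)"
begin

definition psi :: "'a \<Rightarrow> real" where "psi y = support_fun G y - support_fun H y"

lemma psi_zero: "psi 0 = 0"
  by (simp add: psi_def support_fun_zero G(2) H(2))

text \<open>The upper set relation writes any \<open>h\<close> in the face of \<open>H\<close> as
  \<open>g - c\<close> with \<open>g\<close> in the face of \<open>G\<close> and \<open>c\<close> in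
  the dual cone.\<close>

lemma exists_face_selection:
  obtains g h where "\<And>y. g y \<in> face G y" "\<And>y. h y \<in> face H y" "\<And>y. g y - h y \<in> dual_cone K"
proof -
  have "\<exists>g h. g \<in> face G y \<and> h \<in> face H y \<and> g - h \<in> dual_cone K" for y
  proof -
    obtain h where h: "h \<in> face H y" using face_nonempty[OF H] by blast
    then obtain g c where "g \<in> face G y" "c \<in> dual_cone K" "h = g - c"
      using faces[of y] unfolding set_less_def upper_less_def minkowski_diff_def by blast
    with h show ?thesis by (intro exI[of _ g] exI[of _ h]) simp
  qed
  then show thesis using that by metis
qed

lemma psi_mono:
  assumes k: "z - y \<in> K"
  shows "psi y \<le> psi z"
proof -
  let ?k = "z - y"
  obtain g h where gh: "\<And>u. g u \<in> face G u" "\<And>u. h u \<in> face H u" "\<And>u. g u - h u \<in> dual_cone K"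
    using exists_face_selection by blast
  define b where "b t = blinfun_apply (h (y + t *\<^sub>R ?k)) ?k" for t :: real
  \<comment> \<open>The increment of the \<open>G\<close> part is bounded by a subgradient at the
    left end, that of the \<open>H\<close> part by one at the right end. Replacing \<open>g\<close>
    by \<open>h\<close> at the left end leaves only values of \<open>b\<close>.\<close>
  have step: "(t - s) * (b s - b t) \<le> psi (y + t *\<^sub>R ?k) - psi (y + s *\<^sub>R ?k)" if "s \<le> t" for s t
  proof -
    let ?u = "y + s *\<^sub>R ?k" and ?v = "y + t *\<^sub>R ?k"
    have d: "?v - ?u = (t - s) *\<^sub>R ?k" "?u - ?v = - ((t - s) *\<^sub>R ?k)"
      by (simp_all add: algebra_simps)
    have 1: "(t - s) * blinfun_apply (g ?u) ?k \<le> support_fun G ?v - support_fun G ?u"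
      using face_subgradient[OF G(1) gh(1), of ?u ?v] unfolding d by (simp add: blinfun.scaleR_right)
    have 2: "- ((t - s) * b t) \<le> support_fun H ?u - support_fun H ?v"
      using face_subgradient[OF H(1) gh(2), of ?v ?u] unfolding d b_def
      by (simp add: blinfun.scaleR_right blinfun.minus_right)
    have "b s \<le> blinfun_apply (g ?u) ?k"
      using gh(3)[of ?u] k by (auto simp: dual_cone_def b_def blinfun.diff_left)
    then have "(t - s) * b s \<le> (t - s) * blinfun_apply (g ?u) ?k"
      using that by (intro mult_left_mono) auto
    with 1 2 show ?thesis by (simp add: psi_def algebra_simps)
  qed
  \<comment> \<open>Summing \<open>step\<close> over a mesh of width \<open>1 / n\<close> telescopes
    the values of \<open>b\<close> and keeps the factor \<open>1 / n\<close>.\<close>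
  have tele: "(b 0 - b (real m / real n)) / real n \<le> psi (y + (real m / real n) *\<^sub>R ?k) - psi y"
    if "n > 0" for m n :: nat
  proof (induction m)
    case (Suc m)
    have "real (Suc m) / real n - real m / real n = 1 / real n"
      by (simp flip: diff_divide_distrib)
    then have "(1 / real n) * (b (real m / real n) - b (real (Suc m) / real n))
        \<le> psi (y + (real (Suc m) / real n) *\<^sub>R ?k) - psi (y + (real m / real n) *\<^sub>R ?k)"
      using step[of "real m / real n" "real (Suc m) / real n"] by (simp add: divide_right_mono)
    with Suc show ?case by (simp add: diff_divide_distrib)
  qed simp
  \<comment> \<open>Taking all \<open>Suc n\<close> steps reaches \<open>z\<close>; the successor
    keeps the denominator nonzero.\<close>
  have "(b 0 - b 1) / real (Suc n) \<le> psi z - psi y" for n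
    using tele[of "Suc n" "Suc n"] by (simp del: of_nat_Suc)
  moreover have "(\<lambda>n. (b 0 - b 1) / real (Suc n)) \<longlonglongrightarrow> 0"
    using LIMSEQ_Suc[OF lim_const_over_n] by simp
  ultimately have "0 \<le> psi z - psi y"
    by (intro LIMSEQ_le_const2[of "\<lambda>n. (b 0 - b 1) / real (Suc n)"]) auto
  then show ?thesis by simp
qed

lemma psi_strict_mono:
  assumes "cone K" and disj: "H \<inter> G = {}" and k: "z - y \<in> interior K"
  shows "psi y < psi z"
proof (rule ccontr)
  let ?k = "z - y"
  assume "\<not> psi y < psi z"
  have kK: "?k \<in> K" using k interior_subset by blast
  have seg: "psi (y + s *\<^sub>R ?k) \<le> psi (y + t *\<^sub>R ?k)" if "s \<le> t" for s t
  proof -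
    have "(t - s) *\<^sub>R ?k \<in> K" using \<open>cone K\<close> kK that by (auto simp: cone_def)
    moreover have "(y + t *\<^sub>R ?k) - (y + s *\<^sub>R ?k) = (t - s) *\<^sub>R ?k" by (simp add: algebra_simps)
    ultimately show ?thesis by (intro psi_mono) simp
  qed
  \<comment> \<open>By monotonicity the value lies between \<open>psi y\<close> and
    \<open>psi z\<close>, and \<open>psi z \<le> psi y\<close> by the assumption for
    contradiction.\<close>
  have const: "psi (y + t *\<^sub>R ?k) = psi y" if "0 \<le> t" "t \<le> 1" for t
    using seg[of 0 t] seg[of t 1] that \<open>\<not> psi y < psi z\<close> by simp
  obtain g h where gh: "\<And>u. g u \<in> face G u" "\<And>u. h u \<in> face H u" "\<And>u. g u - h u \<in> dual_cone K"
    using exists_face_selection by blast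
  define a b where "a t = blinfun_apply (g (y + t *\<^sub>R ?k)) ?k"
    and "b t = blinfun_apply (h (y + t *\<^sub>R ?k)) ?k" for t :: real
  have ba: "b t \<le> a t" for t
    using gh(3)[of "y + t *\<^sub>R ?k"] kK by (auto simp: dual_cone_def a_def b_def blinfun.diff_left)
  \<comment> \<open>Since \<open>psi\<close> is constant, both support functions have the same
    increment, which is at least \<open>(t - s) * a s\<close> and at most
    \<open>(t - s) * b t\<close>.\<close>
  have ab: "a s \<le> b t" if "0 < s" "s < t" "t < 1" for s t
  proof -
    let ?u = "y + s *\<^sub>R ?k" and ?v = "y + t *\<^sub>R ?k"
    have d: "?v - ?u = (t - s) *\<^sub>R ?k" "?u - ?v = - ((t - s) *\<^sub>R ?k)"
      by (simp_all add: algebra_simps)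
    have "(t - s) * a s \<le> support_fun G ?v - support_fun G ?u"
      using face_subgradient[OF G(1) gh(1), of ?u ?v] unfolding d a_def
      by (simp add: blinfun.scaleR_right)
    moreover have "- ((t - s) * b t) \<le> support_fun H ?u - support_fun H ?v"
      using face_subgradient[OF H(1) gh(2), of ?v ?u] unfolding d b_def
      by (simp add: blinfun.scaleR_right blinfun.minus_right)
    moreover have "psi ?u = psi ?v" using const[of s] const[of t] that by simp
    ultimately have "(t - s) * a s \<le> (t - s) * b t" by (simp add: psi_def)
    then show ?thesis using that by simp
  qed
  have "mono_on {0<..<1} b"
  proof (rule mono_onI)
    fix s t :: real assume "s \<in> {0<..<1}" "t \<in> {0<..<1}" "s \<le> t"
    then show "b s \<le> b t" using ba[of s] ab[of s t] by (cases "s = t") auto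
  qed
  \<comment> \<open>Monotone functions have countably many discontinuities, so \<open>b\<close> is
    continuous somewhere in the open unit interval.\<close>
  then have "countable {t \<in> {0<..<1}. \<not> isCont b t}"
    by (intro mono_on_ctble_discont_open) auto
  moreover have "uncountable {0<..<1::real}" by (simp add: uncountable_open_interval)
  ultimately have "{0<..<1} \<noteq> {t \<in> {0<..<1}. \<not> isCont b t}" by metis
  then obtain t where t: "0 < t" "t < 1" "isCont b t" by auto
  have "(b \<longlongrightarrow> b t) (at_right t)"
    using t(3) by (simp add: isCont_def filterlim_at_split)
  \<comment> \<open>The bound \<open>ab\<close> needs a strictly later point, hence the limit from
    the right, within the interval from \<open>t\<close> to 1.\<close>
  moreover have "eventually (\<lambda>s. a t \<le> b s) (at_right t)"
    unfolding eventually_at_right_field using ab t by (intro exI[of _ 1]) auto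
  ultimately have "a t \<le> b t" by (intro tendsto_lowerbound) auto
  with ba[of t] have "a t = b t" by simp
  let ?u = "y + t *\<^sub>R ?k"
  have "g ?u - h ?u = 0"
    using \<open>a t = b t\<close>
    by (intro dual_cone_eq_zero_of_interior[OF gh(3) k]) (simp add: a_def b_def blinfun.diff_left)
  then show False using gh(1,2)[of ?u] disj by (auto simp: face_def)
qed

text \<open>For \<open>t \<ge> 0\<close> each support function on the ray lies between two affine
  functions of \<open>t\<close> that agree at 0: one from a subgradient at \<open>y\<close>, one
  from subadditivity.\<close>

lemma psi_tendsto_along_ray:
  "((\<lambda>t. psi (y + t *\<^sub>R e)) \<longlongrightarrow> psi y) (at_right 0)"
proof -
  have "((\<lambda>t. support_fun A (y + t *\<^sub>R e)) \<longlongrightarrow> support_fun A y) (at_right 0)"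
    if A: "compactin weak_star_topology A" "A \<noteq> {}" for A :: "('a \<Rightarrow>\<^sub>L real) set"
  proof -
    obtain f where f: "f \<in> face A y" using face_nonempty[OF A] by blast
    have lower: "support_fun A y + t * blinfun_apply f e \<le> support_fun A (y + t *\<^sub>R e)" for t
      using face_subgradient[OF A(1) f, of "y + t *\<^sub>R e"] by (simp add: blinfun.scaleR_right)
    have upper: "support_fun A (y + t *\<^sub>R e) \<le> support_fun A y + t * support_fun A e"
      if "0 \<le> t" for t
      unfolding support_fun_def[of A "y + t *\<^sub>R e"]
      using A that blinfun_le_support_fun[OF A(1)]
      by (intro cSUP_least) (auto simp: blinfun.add_right blinfun.scaleR_right intro!: add_mono mult_left_mono)
    show ?thesis
    proof (rule tendsto_sandwich)
      show "eventually (\<lambda>t. support_fun A y + t * blinfun_apply f e \<le> support_fun A (y + t *\<^sub>R e)) (at_right 0)"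
        using lower by simp
      show "eventually (\<lambda>t. support_fun A (y + t *\<^sub>R e) \<le> support_fun A y + t * support_fun A e) (at_right 0)"
        using upper by (auto simp: eventually_at_right_field intro!: exI[of _ 1])
    qed (auto intro!: tendsto_eq_intros)
  qed
  then show ?thesis unfolding psi_def using G H by (intro tendsto_diff) auto
qed

text \<open>With \<open>h = g - p\<close> attaining the support function of \<open>H\<close> at
  \<open>y\<close>, that value falls below \<open>g y\<close> by the positive amount
  \<open>p y\<close>.\<close>

lemma psi_pos:
  assumes sep: "H \<subseteq> minkowski_diff G (interior (nonneg_functionals y))" and "y \<noteq> 0"
  shows "0 < psi y"
proof -
  obtain h where h: "h \<in> face H y" using face_nonempty[OF H] by blast
  then have "h \<in> H" by (simp add: face_def)
  then obtain g p where gp: "h = g - p" "g \<in> G" "p \<in> interior (nonneg_functionals y)"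
    using sep by (auto simp: minkowski_diff_def)
  have "support_fun H y = blinfun_apply g y - blinfun_apply p y"
    using h gp(1) by (simp add: face_def blinfun.diff_left)
  moreover have "0 < blinfun_apply p y"
    using gp(3) \<open>y \<noteq> 0\<close> by (rule blinfun_pos_of_interior_nonneg_functionals)
  moreover have "blinfun_apply g y \<le> support_fun G y"
    using blinfun_le_support_fun[OF G(1) gp(2)] .
  ultimately show ?thesis by (simp add: psi_def)
qed

end

section \<open>Interior of a convex cone, and the sublevel sets\<close>

lemma convex_cone_add_interior:
  fixes K :: "'a::real_normed_vector set"
  assumes "convex K" "cone K" "x \<in> K" "e \<in> interior K"
  shows "x + e \<in> interior K"
\<comment> \<open>The translate of the interior by \<open>x\<close> is open and lies in
  \<open>K\<close>, hence in its interior.\<close>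
proof (rule interior_maximal[THEN subsetD])
  show "(+) x ` interior K \<subseteq> K"
    using assms interior_subset[of K] convex_cone[of K] by auto
  show "open ((+) x ` interior K)" by (intro open_translation) simp
qed (use assms in auto)

lemma cone_scaleR_interior:
  fixes K :: "'a::real_normed_vector set"
  assumes "cone K" "e \<in> interior K" "0 < (t::real)"
  shows "t *\<^sub>R e \<in> interior K"
proof (rule interior_maximal[THEN subsetD])
  show "(*\<^sub>R) t ` interior K \<subseteq> K"
    using assms interior_subset[of K] by (auto simp: cone_def)
  show "open ((*\<^sub>R) t ` interior K)" using \<open>0 < t\<close> by (intro open_scaling) auto
qed (use assms in auto)

theorem theorem5p7:
  fixes K :: "'a::real_normed_vector set" and \<Psi> :: "'a \<Rightarrow> real"
  assumes "closed K" and "convex K" and "cone K" and "pointed K"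
    and "\<Psi> \<in> Omega_QD K"
  shows "K_monotone K \<Psi> \<and>
    uminus ` K = {y. \<Psi> y \<le> 0} \<and>
    (interior K \<noteq> {} \<longrightarrow>
      strictly_K_monotone K \<Psi> \<and> uminus ` interior K = {y. \<Psi> y < 0})"
proof -
  obtain G H where GH: "(G, H) \<in> scalarization_pairs K"
    and \<Psi>: "\<Psi> = (\<lambda>y. support_fun G y - support_fun H y)"
    using assms(5) by (auto simp: Omega_QD_def)
  interpret support_pair K G H
    using GH by unfold_locales (auto simp: scalarization_pairs_def)
  have [simp]: "\<Psi> = psi" by (simp add: \<Psi> psi_def fun_eq_iff)
  have disj: "H \<inter> G = {}" using GH by (auto simp: scalarization_pairs_def)
  have "0 \<in> uminus ` K"
    using \<open>pointed K\<close> unfolding pointed_def by blast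
  have pos: "0 < psi y" if "y \<notin> uminus ` K" for y
  proof (rule psi_pos)
    have "H \<subseteq> (\<Inter>y\<in>- (uminus ` K). minkowski_diff G (interior (nonneg_functionals y)))"
      using GH by (simp add: scalarization_pairs_def)
    then show "H \<subseteq> minkowski_diff G (interior (nonneg_functionals y))" using that by blast
    \<comment> \<open>Pointedness puts 0 into \<open>- K\<close>, so a point outside
      \<open>- K\<close> is nonzero.\<close>
    show "y \<noteq> 0" using that \<open>0 \<in> uminus ` K\<close> by metis
  qed
  have "psi (- k) \<le> 0" if "k \<in> K" for k
    using psi_mono[of 0 "- k"] that psi_zero by simp
  then have level: "uminus ` K = {y. psi y \<le> 0}"
    using pos by (force simp: not_le[symmetric])
  have strict: "strictly_K_monotone K psi"
    using psi_strict_mono[OF \<open>cone K\<close> disj] by (simp add: strictly_K_monotone_def)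
  have "uminus ` interior K = {y. psi y < 0}" if "interior K \<noteq> {}"
  proof (intro equalityI subsetI)
    fix y assume "y \<in> uminus ` interior K"
    then have "psi y < psi 0" by (intro psi_strict_mono[OF \<open>cone K\<close> disj]) auto
    then show "y \<in> {y. psi y < 0}" using psi_zero by simp
  next
    fix y assume "y \<in> {y. psi y < 0}"
    then have neg: "psi y < 0" by simp
    obtain e where e: "e \<in> interior K" using \<open>interior K \<noteq> {}\<close> by blast
    have "eventually (\<lambda>t. psi (y + t *\<^sub>R e) < 0) (at_right 0)"
      using psi_tendsto_along_ray neg by (rule order_tendstoD)
    then obtain d where "d > 0" "\<And>t. 0 < t \<Longrightarrow> t < d \<Longrightarrow> psi (y + t *\<^sub>R e) < 0"
      by (auto simp: eventually_at_right_field)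
    then obtain t where t: "t > 0" "psi (y + t *\<^sub>R e) < 0" by (meson dense)
    then have "y + t *\<^sub>R e \<in> uminus ` K" using level by auto
    then have "- (y + t *\<^sub>R e) \<in> K" by (metis add.inverse_inverse imageE)
    \<comment> \<open>This sum equals \<open>- y\<close>: an element of \<open>K\<close> plus the
      interior point \<open>t *\<^sub>R e\<close>.\<close>
    then have "- (y + t *\<^sub>R e) + t *\<^sub>R e \<in> interior K"
      by (rule convex_cone_add_interior[OF assms(2,3) _ cone_scaleR_interior[OF assms(3) e t(1)]])
    then have "- y \<in> interior K" by simp
    then show "y \<in> uminus ` interior K" by (metis add.inverse_inverse imageI)
  qed
  then show ?thesis
    using level strict psi_mono by (simp add: K_monotone_def)
qed

end
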